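(* Let $K$ be an algebraically closed field, let $M=\mathbb{P}^1\times\mathbb{P}^1$ over $K$, and let $a\geq 0$ and $k\geq 0$ be integers. Choose $k+1$ pairwise different lines $L_1,\dots,L_{k+1}$ of type $(1,0)$ on $M$, and for $1\leq i\leq k+1$ choose an effective divisor $D_i$ of degree $y_i$ on $L_i$, where $a\geq y_1\geq y_2\geq\dots\geq y_{k+1}\geq 0$ (so some divisors $D_i$ are allowed to be $0$, and they need not be reduced). Then $$\dim\left(\vert(k,a)-D_1-\dots-D_{k+1}\vert\right)=ka+k+a-y_1-\dots-y_{k+1}.$$
   Context: Let $pr_1,pr_2:M=\mathbb{P}^1\times\mathbb{P}^1\to\mathbb{P}^1$ be the two projections. A line of type $(1,0)$ is a fiber $pr_1^{-1}(P)$ and a line of type $(0,1)$ is a fiber $pr_2^{-1}(P)$, with $P\in\mathbb{P}^1$. The classes $(1,0)$ and $(0,1)$ of these lines freely generate $\mathrm{Pic}(M)$; write $(a,b)=a\cdot(1,0)+b\cdot(0,1)$. The intersection number is $(a,b).(a',b')=ab'+ba'$ (so a curve of class $(k,a)$ meets a line of type $(1,0)$ in degree $a$). $\vert(a,b)\vert$ denotes the complete linear system of effective divisors of class $(a,b)$; for $a,b\geq 0$ its dimension as a projective space is $(a+1)(b+1)-1$. For a $0$-dimensional closed subscheme $Z$ of $M$, $\vert(a,b)-Z\vert$ denotes the linear subspace of $\vert(a,b)\vert$ consisting of the divisors that contain $Z$ as a closed subscheme; for disjoint $0$-dimensional subschemes $Z_1,Z_2$, $Z_1+Z_2$ denotes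 their union and $\vert(a,b)-Z_1-Z_2\vert=\vert(a,b)-(Z_1+Z_2)\vert$. An effective divisor $D_i$ on $L_i$ is regarded as a $0$-dimensional closed subscheme of $M$ through $L_i\subset M$. The dimension $\dim$ of a linear system is its dimension as a projective space. *)

theory Defs
  imports
    "HOL-Computational_Algebra.Polynomial"
    "HOL-Library.Poly_Mapping"
    "HOL-Library.Multiset"
begin

text \<open>Over an algebraically closed field the closed points of \<open>P\<^sup>1\<close> are the classes
  \<open>[x\<^sub>0 : x\<^sub>1]\<close> of nonzero vectors up to scaling, and the closed points of
  \<open>M = P\<^sup>1 \<times> P\<^sup>1\<close> are pairs of these.\<close>

definition proportional :: "'k::field \<times> 'k \<Rightarrow> 'k \<times> 'k \<Rightarrow> bool" where
  "proportional u v \<longleftrightarrow>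
     u \<noteq> (0, 0) \<and> v \<noteq> (0, 0) \<and> (\<exists>c. c \<noteq> 0 \<and> v = (c * fst u, c * snd u))"

quotient_type (overloaded) 'k p1 = "('k::field) \<times> 'k" / partial: proportional
proof (rule part_equivpI)
  show "\<exists>x :: 'k \<times> 'k. proportional x x"
    by (rule exI[of _ "(1, 0)"]) (auto simp: proportional_def intro!: exI[of _ 1])
  show "symp (proportional :: 'k \<times> 'k \<Rightarrow> _)"
  proof (rule sympI)
    fix u v :: "'k \<times> 'k"
    assume "proportional u v"
    then obtain c where "u \<noteq> (0, 0)" "v \<noteq> (0, 0)" "c \<noteq> 0" "v = (c * fst u, c * snd u)"
      unfolding proportional_def by blast
    then show "proportional v u"
      unfolding proportional_def by (intro conjI exI[of _ "inverse c"]) (auto simp: prod_eq_iff)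
  qed
  show "transp (proportional :: 'k \<times> 'k \<Rightarrow> _)"
  proof (rule transpI)
    fix u v w :: "'k \<times> 'k"
    assume "proportional u v" "proportional v w"
    then obtain c d where "u \<noteq> (0, 0)" "w \<noteq> (0, 0)" "c \<noteq> 0" "v = (c * fst u, c * snd u)"
        "d \<noteq> 0" "w = (d * fst v, d * snd v)"
      unfolding proportional_def by blast
    then show "proportional u w"
      unfolding proportional_def by (intro conjI exI[of _ "d * c"]) auto
  qed
qed

type_synonym 'k point = "'k p1 \<times> 'k p1"

definition lines_1_0 :: "'k::field point set set" where
  "lines_1_0 = {fst -` {P} | P. True}"

text \<open>The standard affine charts \<open>U0 = {x\<^sub>0 \<noteq> 0}\<close> and \<open>U1 = {x\<^sub>1 \<noteq> 0}\<close> of \<open>P\<^sup>1\<close>, with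
  coordinate \<open>x\<^sub>1 / x\<^sub>0\<close> on the former and \<open>x\<^sub>0 / x\<^sub>1\<close> on the latter.\<close>

datatype chart = U0 | U1

lift_definition in_chart :: "chart \<Rightarrow> 'k::field p1 \<Rightarrow> bool" is
  "\<lambda>u x. case u of U0 \<Rightarrow> fst x \<noteq> 0 | U1 \<Rightarrow> snd x \<noteq> 0"
  by (auto simp: proportional_def split: chart.splits)

lift_definition chart_coord :: "chart \<Rightarrow> 'k::field p1 \<Rightarrow> 'k" is
  "\<lambda>u x. case u of U0 \<Rightarrow> snd x / fst x | U1 \<Rightarrow> fst x / snd x"
  by (auto simp: proportional_def split: chart.splits)

text \<open>\<open>M\<close> is covered by the four affine planes \<open>U \<times> V\<close> with \<open>U, V\<close> standard charts of \<open>P\<^sup>1\<close>.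
  The coordinate ring of \<open>U \<times> V\<close> is \<open>K[s, t] = K[t][s]\<close>, where \<open>s\<close> (the outer variable) is the
  coordinate of \<open>U\<close> in the first factor and \<open>t\<close> (the inner variable) that of \<open>V\<close> in the second.
  A closed subscheme is given by its ideal sheaf, that is, by its ideals on these four planes.
  The type below does not impose that they are ideals agreeing on overlaps; all subschemes
  constructed below are of this kind.\<close>

type_synonym 'k subscheme = "chart \<times> chart \<Rightarrow> 'k poly poly set"

definition contained_in :: "'k::field subscheme \<Rightarrow> 'k subscheme \<Rightarrow> bool" where
  "contained_in Z C \<longleftrightarrow> (\<forall>u. C u \<subseteq> Z u)"

definition scheme_union :: "'i set \<Rightarrow> ('i \<Rightarrow> 'k::field subscheme) \<Rightarrow> 'k subscheme" where
  "scheme_union I Z = (\<lambda>u. \<Inter>i\<in>I. Z i u)"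

text \<open>An effective divisor on a line \<open>L\<close> is a finite formal sum of points of \<open>L\<close>, encoded as a
  multiset; its degree is its size.\<close>

definition effective_divisor_on :: "'k::field point set \<Rightarrow> 'k point multiset \<Rightarrow> bool" where
  "effective_divisor_on L D \<longleftrightarrow> set_mset D \<subseteq> L"

text \<open>The divisor \<open>D\<close> on \<open>L = pr\<^sub>1\<^sup>-\<^sup>1(P)\<close>, regarded as a closed subscheme of \<open>M\<close>. Its ideal is the
  preimage under the restriction \<open>O\<^sub>M \<rightarrow> O\<^sub>L\<close> of the ideal \<open>O\<^sub>L(-D)\<close>. Restricting \<open>f(s, t)\<close> to \<open>L\<close>
  means putting \<open>s = s(P)\<close>, and \<open>O\<^sub>L(-D)\<close> consists of the functions that vanish at every point
  \<open>p\<close> to order at least the multiplicity of \<open>p\<close> in \<open>D\<close>. Every \<open>p\<close> in \<open>D\<close> has first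
  component \<open>P\<close>.\<close>

definition line_divisor_scheme :: "'k::field point multiset \<Rightarrow> 'k subscheme" where
  "line_divisor_scheme D = (\<lambda>(u, v). {f. \<forall>p \<in># D. in_chart u (fst p) \<and> in_chart v (snd p) \<longrightarrow>
     [:- chart_coord v (snd p), 1:] ^ count D p dvd poly f [:chart_coord u (fst p):]})"

datatype coord = X0 | X1 | Y0 | Y1

type_synonym 'k mform = "(coord \<Rightarrow>\<^sub>0 nat) \<Rightarrow>\<^sub>0 'k"

definition form_scale :: "'k::field \<Rightarrow> 'k mform \<Rightarrow> 'k mform" where
  "form_scale c F = Poly_Mapping.map ((*) c) F"

lemma lookup_form_scale [simp]:
  "Poly_Mapping.lookup (form_scale c F) m = c * Poly_Mapping.lookup F m"
  unfolding form_scale_def by transfer (simp add: when_def)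

interpretation form: vector_space "form_scale :: 'k::field \<Rightarrow> _"
  by unfold_locales (auto intro!: poly_mapping_eqI simp: lookup_add algebra_simps)

text \<open>The global sections of \<open>O(k,a)\<close>: bihomogeneous forms of degree \<open>k\<close> in \<open>X\<^sub>0, X\<^sub>1\<close> and
  \<open>a\<close> in \<open>Y\<^sub>0, Y\<^sub>1\<close>. The line \<open>pr\<^sub>1\<^sup>-\<^sup>1(P)\<close> of type \<open>(1,0)\<close> is the zero scheme of a form
  of bidegree \<open>(1,0)\<close>.\<close>

definition forms :: "nat \<Rightarrow> nat \<Rightarrow> 'k::field mform set" where
  "forms k a = {F. \<forall>m \<in> Poly_Mapping.keys F.
     Poly_Mapping.lookup m X0 + Poly_Mapping.lookup m X1 = k \<and>
     Poly_Mapping.lookup m Y0 + Poly_Mapping.lookup m Y1 = a}"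

fun x_coord :: "chart \<Rightarrow> coord" where
  "x_coord U0 = X1" | "x_coord U1 = X0"

fun y_coord :: "chart \<Rightarrow> coord" where
  "y_coord U0 = Y1" | "y_coord U1 = Y0"

text \<open>Dehomogenization on \<open>U \<times> V\<close>: the two coordinates invertible there are set to 1, the other
  two become \<open>s\<close> and \<open>t\<close>.\<close>

definition dehomogenize :: "chart \<times> chart \<Rightarrow> 'k::field mform \<Rightarrow> 'k poly poly" where
  "dehomogenize = (\<lambda>(u, v) F. \<Sum>m \<in> Poly_Mapping.keys F.
     monom (monom (Poly_Mapping.lookup F m) (Poly_Mapping.lookup m (y_coord v)))
           (Poly_Mapping.lookup m (x_coord u)))"

definition zero_scheme :: "'k::field mform \<Rightarrow> 'k subscheme" where
  "zero_scheme F = (\<lambda>u. {f. dehomogenize u F dvd f})"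

text \<open>The effective divisors of class \<open>(k,a)\<close> are the zero schemes of the nonzero sections of
  \<open>O(k,a)\<close>.\<close>

definition linear_system :: "nat \<Rightarrow> nat \<Rightarrow> 'k::field subscheme set" where
  "linear_system k a = {zero_scheme F | F. F \<in> forms k a \<and> F \<noteq> 0}"

definition linear_system_minus :: "nat \<Rightarrow> nat \<Rightarrow> 'k::field subscheme \<Rightarrow> 'k subscheme set" where
  "linear_system_minus k a Z = {C \<in> linear_system k a. contained_in Z C}"

text \<open>\<open>|(k,a)|\<close> is the projective space of lines in \<open>H\<^sup>0(M, O(k,a))\<close>; a linear subspace
  \<open>S\<close> of it has as dimension that of the corresponding vector space of sections minus one
  (so the empty system has dimension \<open>-1\<close>). That this is meaningful for
  \<open>|(k,a) - Z|\<close> is the content of \<open>subspace_section_space\<close> and \<open>zero_scheme_eqD\<close>.\<close>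

definition section_space :: "nat \<Rightarrow> nat \<Rightarrow> 'k::field subscheme set \<Rightarrow> 'k mform set" where
  "section_space k a S = {F \<in> forms k a. F = 0 \<or> zero_scheme F \<in> S}"

definition linear_system_dim :: "nat \<Rightarrow> nat \<Rightarrow> 'k::field subscheme set \<Rightarrow> int" where
  "linear_system_dim k a S = int (form.dim (section_space k a S)) - 1"

definition poly_ideal :: "'a::comm_ring_1 set \<Rightarrow> bool" where
  "poly_ideal I \<longleftrightarrow> 0 \<in> I \<and> (\<forall>f\<in>I. \<forall>g\<in>I. f + g \<in> I) \<and> (\<forall>f\<in>I. \<forall>h. h * f \<in> I)"

lemma poly_ideal_line_divisor_scheme: "poly_ideal (line_divisor_scheme D u)"
  by (cases u) (auto simp: line_divisor_scheme_def poly_ideal_def)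

lemma poly_ideal_scheme_union:
  "(\<And>i. i \<in> I \<Longrightarrow> poly_ideal (Z i u)) \<Longrightarrow> poly_ideal (scheme_union I Z u)"
  by (auto simp: scheme_union_def poly_ideal_def)

lemma dehomogenize_superset:
  assumes "finite A" "Poly_Mapping.keys F \<subseteq> A"
  shows "dehomogenize (u, v) F = (\<Sum>m \<in> A.
     monom (monom (Poly_Mapping.lookup F m) (Poly_Mapping.lookup m (y_coord v)))
           (Poly_Mapping.lookup m (x_coord u)))"
  unfolding dehomogenize_def prod.case
  by (rule sum.mono_neutral_left) (use assms in \<open>auto simp: in_keys_iff\<close>)

lemma dehomogenize_add: "dehomogenize u (F + G) = dehomogenize u F + dehomogenize u G"
proof -
  obtain b c where u: "u = (b, c)" by (cases u)
  let ?A = "Poly_Mapping.keys F \<union> Poly_Mapping.keys G"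
  have "Poly_Mapping.keys (F + G) \<subseteq> ?A" by (rule keys_add)
  then show ?thesis unfolding u
    by (simp add: dehomogenize_superset[of ?A] lookup_add add_monom[symmetric] sum.distrib)
qed

lemma dehomogenize_scale: "dehomogenize u (form_scale c F) = [:[:c:]:] * dehomogenize u F"
proof -
  obtain b d where u: "u = (b, d)" by (cases u)
  have "Poly_Mapping.keys (form_scale c F) \<subseteq> Poly_Mapping.keys F" by (auto simp: in_keys_iff)
  then show ?thesis unfolding u
    by (simp add: dehomogenize_superset[of "Poly_Mapping.keys F"] sum_distrib_left smult_monom)
qed

lemma dehomogenize_0 [simp]: "dehomogenize u 0 = 0"
  by (cases u) (simp add: dehomogenize_def)

lemma subspace_forms: "form.subspace (forms k a)"
proof (rule form.subspaceI)
  fix F G :: "'k::field mform" and c :: 'k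
  assume F: "F \<in> forms k a"
  show "form_scale c F \<in> forms k a" using F by (auto simp: forms_def in_keys_iff)
  assume "G \<in> forms k a"
  then show "F + G \<in> forms k a"
    using F keys_add[of F G] unfolding forms_def by blast
qed (auto simp: forms_def)

lemma section_space_linear_system_minus:
  assumes "\<And>u. poly_ideal (Z u)"
  shows "section_space k a (linear_system_minus k a Z) =
    {F \<in> forms k a. \<forall>u. dehomogenize u F \<in> Z u}"
proof -
  have mult: "f * h \<in> Z u" if "f \<in> Z u" for f h u
    using assms that unfolding poly_ideal_def by (metis mult.commute)
  have "{g. f dvd g} \<subseteq> Z u \<longleftrightarrow> f \<in> Z u" for f u
  proof
    show "f \<in> Z u \<Longrightarrow> {g. f dvd g} \<subseteq> Z u" by (clarify elim!: dvdE) (rule mult)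
  qed auto
  then have *: "contained_in Z (zero_scheme F) \<longleftrightarrow> (\<forall>u. dehomogenize u F \<in> Z u)" for F
    unfolding contained_in_def zero_scheme_def by simp
  show ?thesis
    using assms unfolding section_space_def linear_system_minus_def linear_system_def
    by (auto simp: * poly_ideal_def)
qed

lemma subspace_section_space:
  assumes "\<And>u. poly_ideal (Z u)"
  shows "form.subspace (section_space k a (linear_system_minus k a Z))"
proof -
  have "[:[:c:]:] * f \<in> Z u" if "f \<in> Z u" for c f u
    using assms that unfolding poly_ideal_def by blast
  then show ?thesis
    unfolding section_space_linear_system_minus[OF assms]
    using subspace_forms[of k a] assms
    by (auto simp: form.subspace_def dehomogenize_add dehomogenize_scale poly_ideal_def
      simp del: mult_pCons_left)
qed

lemma dehomogenize_eq_0: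
  assumes "F \<in> forms k a" "dehomogenize (U0, U0) F = 0"
  shows "F = 0"
proof (rule ccontr)
  assume "F \<noteq> 0"
  then obtain n where n: "n \<in> Poly_Mapping.keys F"
    by (metis all_not_in_conv keys_eq_empty)
  have eq: "m = n" if "m \<in> Poly_Mapping.keys F"
    "Poly_Mapping.lookup m X1 = Poly_Mapping.lookup n X1"
    "Poly_Mapping.lookup m Y1 = Poly_Mapping.lookup n Y1" for m
  proof (rule poly_mapping_eqI)
    fix z
    have "Poly_Mapping.lookup l X0 + Poly_Mapping.lookup l X1 = k"
        "Poly_Mapping.lookup l Y0 + Poly_Mapping.lookup l Y1 = a"
      if "l \<in> Poly_Mapping.keys F" for l
      using that assms(1) by (auto simp: forms_def)
    from this[OF that(1)] this[OF n] that(2,3)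
    show "Poly_Mapping.lookup m z = Poly_Mapping.lookup n z"
      by (cases z) auto
  qed
  have "coeff (coeff (dehomogenize (U0, U0) F) (Poly_Mapping.lookup n X1))
      (Poly_Mapping.lookup n Y1) =
    (\<Sum>m \<in> Poly_Mapping.keys F. if m = n then Poly_Mapping.lookup F n else 0)"
    unfolding dehomogenize_def prod.case coeff_sum
    by (rule sum.cong) (use eq in \<open>auto simp: coeff_monom\<close>)
  also have "\<dots> = Poly_Mapping.lookup F n" using n by simp
  finally show False using n assms(2) by (simp add: in_keys_iff)
qed

lemma zero_scheme_eqD:
  assumes F: "F \<in> forms k a" and G: "G \<in> forms k a" and eq: "zero_scheme F = zero_scheme G"
  shows "\<exists>c. c \<noteq> 0 \<and> G = form_scale c F"
proof -
  let ?f = "dehomogenize (U0, U0) F" and ?g = "dehomogenize (U0, U0) G"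
  have iff: "?f dvd h \<longleftrightarrow> ?g dvd h" for h
    using fun_cong[OF eq, of "(U0, U0)"] by (auto simp: zero_scheme_def)
  have dvd: "?f dvd ?g" "?g dvd ?f"
    by (rule iff[THEN iffD2, OF dvd_refl], rule iff[THEN iffD1, OF dvd_refl])
  show ?thesis
  proof (cases "?f = 0")
    case True
    then have "?g = 0" using dvd(1) by simp
    then have "F = 0" "G = 0" using True F G dehomogenize_eq_0 by blast+
    then show ?thesis by (intro exI[of _ 1]) simp
  next
    case False
    obtain w where w: "?g = ?f * w" using dvd(1) by (rule dvdE)
    obtain w' where w': "?f = ?g * w'" using dvd(2) by (rule dvdE)
    have "?f * (w * w') = ?f * 1"
      by (simp only: mult.assoc[symmetric] w[symmetric] w'[symmetric] mult_1_right)
    then have "w * w' = 1" using False mult_left_cancel by blast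
    then have "is_unit w" by (metis dvd_triv_left)
    then obtain c where c: "w = [:[:c:]:]" "c \<noteq> 0"
      by (auto simp: is_unit_poly_iff dest!: dvd_field_iff[THEN iffD1])
    have "dehomogenize (U0, U0) (G + form_scale (- c) F) = 0"
      unfolding dehomogenize_add dehomogenize_scale w c by (simp add: mult.commute smult_add_left[symmetric])
    moreover have "G + form_scale (- c) F \<in> forms k a"
      using subspace_forms F G by (metis form.subspace_add form.subspace_scale)
    ultimately have "G + form_scale (- c) F = 0" by (rule dehomogenize_eq_0[rotated])
    then have "G = form_scale c F" by (simp add: form.scale_minus_left)
    then show ?thesis using c(2) by blast
  qed
qed

end

theory Submission
  imports Defs
begin

text \<open>Restricting a form of bidegree \<open>(k, a)\<close> to the fibre of \<open>pr\<^sub>1\<close> over a point \<open>P\<close> gives a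
  binary form of degree \<open>a\<close> on that line. For \<open>k + 1\<close> distinct points the simultaneous
  restriction
  \<open>H\<^sup>0(M, O(k,a)) \<rightarrow> \<Oplus>\<^sub>i H\<^sup>0(L\<^sub>i, O(a))\<close>
  is an isomorphism: a form is of degree \<open>k\<close> in \<open>X\<^sub>0, X\<^sub>1\<close>, so it is determined by its values at
  \<open>k + 1\<close> points (\<open>line_restriction_separates\<close>), and these can be prescribed by Lagrange
  interpolation (\<open>ex_lagrange_poly\<close>). A divisor of the linear system contains \<open>D\<^sub>i\<close> if and only if
  the restriction of its form to \<open>L\<^sub>i\<close> is a multiple of the equation of \<open>D\<^sub>i\<close>, with a cofactor
  that is a binary form of degree \<open>a - y\<^sub>i\<close>
  (\<open>dehomogenize_in_line_divisor_scheme_iff\<close>, \<open>vanishes_on_iff\<close>). Since \<open>y\<^sub>i \<le> a\<close>, these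
  cofactors form a space of dimension \<open>a - y\<^sub>i + 1\<close>, and summing over the \<open>k + 1\<close> lines gives the
  dimension of the space of sections.

  The computation takes place on one chart. Forms of bidegree \<open>(k, a)\<close> correspond to polynomials of
  degree at most \<open>k\<close> in \<open>s\<close> and at most \<open>a\<close> in \<open>t\<close>, and passing to the chart at infinity reverses the
  sequence of coefficients with respect to the bound \<open>k\<close> or \<open>a\<close>. Thus the value at infinity is the
  coefficient at the bound, and vanishing to order at least \<open>m\<close> at infinity means that the degree
  is at most the bound minus \<open>m\<close>.

  The dimension is read off from an explicit basis: \<open>e\<^sub>i\<^sub>j\<close> is the Lagrange polynomial of the \<open>i\<close>-th
  point times the equation of \<open>D\<^sub>i\<close> times \<open>t\<^sup>j\<close>, and its dual functional takes the coefficient of \<open>t\<^sup>j\<close>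
  in the quotient of the restriction to \<open>L\<^sub>i\<close> by the equation of \<open>D\<^sub>i\<close>.\<close>

section \<open>Dimension from a dual family of functionals\<close>

text \<open>Duality makes the \<open>e i\<close> independent. They span \<open>V\<close> because a vector and its expansion with
  coefficients \<open>\<phi> i v\<close> differ by a vector that every functional kills.\<close>

lemma (in vector_space) dim_eq_card_dual_family:
  assumes V: "subspace V" and I: "finite I"
    and e: "\<And>i. i \<in> I \<Longrightarrow> e i \<in> V"
    and add: "\<And>i v w. i \<in> I \<Longrightarrow> \<phi> i (v + w) = \<phi> i v + \<phi> i w"
    and scale: "\<And>i c v. i \<in> I \<Longrightarrow> \<phi> i (c *s v) = c * \<phi> i v"
    and dual: "\<And>i j. i \<in> I \<Longrightarrow> j \<in> I \<Longrightarrow> \<phi> i (e j) = (if i = j then 1 else 0)"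
    and sep: "\<And>v. v \<in> V \<Longrightarrow> (\<And>i. i \<in> I \<Longrightarrow> \<phi> i v = 0) \<Longrightarrow> v = 0"
  shows "dim V = card I"
proof -
  have zero: "\<phi> i 0 = 0" if "i \<in> I" for i
    using scale[OF that, of 0 0] by simp
  have \<phi>_sum: "\<phi> i (\<Sum>j\<in>J. c j *s e j) = (\<Sum>j\<in>J. c j * \<phi> i (e j))" if "i \<in> I" for i c J
    by (induction J rule: infinite_finite_induct) (simp_all add: zero add scale that)
  have \<phi>_comb: "\<phi> i (\<Sum>j\<in>I. c j *s e j) = c i" if "i \<in> I" for i c
  proof -
    have "\<phi> i (\<Sum>j\<in>I. c j *s e j) = (\<Sum>j\<in>I. if i = j then c j else 0)"
      unfolding \<phi>_sum[OF that] by (rule sum.cong) (use that in \<open>auto simp: dual\<close>)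
    then show ?thesis using I that by simp
  qed
  have inj: "inj_on e I"
    by (rule inj_onI) (metis dual zero_neq_one)
  have indep: "independent (e ` I)"
    unfolding dependent_finite[OF finite_imageI[OF I]]
  proof (clarify)
    fix u i assume "(\<Sum>v\<in>e ` I. u v *s v) = 0" and i: "i \<in> I" and u: "u (e i) \<noteq> 0"
    then have "(\<Sum>j\<in>I. u (e j) *s e j) = 0"
      by (simp add: sum.reindex[OF inj])
    then show False using \<phi>_comb[OF i, of "\<lambda>j. u (e j)"] zero[OF i] u by simp
  qed
  have "V \<subseteq> span (e ` I)"
  proof
    fix v assume v: "v \<in> V"
    define w where "w = (\<Sum>j\<in>I. \<phi> j v *s e j)"
    have w: "w \<in> V" unfolding w_def
      by (intro subspace_sum[OF V] subspace_scale[OF V] e)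
    have "v + (- 1) *s w = 0"
    proof (rule sep)
      show "v + (- 1) *s w \<in> V" by (intro subspace_add[OF V] subspace_scale[OF V] v w)
      fix i assume i: "i \<in> I"
      show "\<phi> i (v + (- 1) *s w) = 0"
        unfolding add[OF i] scale[OF i] w_def \<phi>_comb[OF i] by simp
    qed
    then have "v = w" by simp
    moreover have "w \<in> span (e ` I)"
      unfolding w_def by (intro span_sum span_scale span_base imageI)
    ultimately show "v \<in> span (e ` I)" by simp
  qed
  moreover have "e ` I \<subseteq> V" using e by blast
  ultimately have "dim V = card (e ` I)" using indep by (metis dim_unique)
  then show ?thesis by (simp add: card_image inj)
qed

section \<open>Reversing coefficients\<close>

text \<open>The change from the coordinate \<open>x\<^sub>1 / x\<^sub>0\<close> to \<open>x\<^sub>0 / x\<^sub>1\<close> for a binary form of degree \<open>n\<close>. Unlike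
  \<open>reflect_poly\<close> it reverses with respect to the degree \<open>n\<close> of the form, which is larger than that of the
  polynomial if the form vanishes at infinity.\<close>
definition flip_poly :: "nat \<Rightarrow> 'a::comm_semiring_0 poly \<Rightarrow> 'a poly" where
  "flip_poly n f = (\<Sum>i\<le>n. monom (coeff f (n - i)) i)"

lemma coeff_flip_poly: "coeff (flip_poly n f) i = (if i \<le> n then coeff f (n - i) else 0)"
  by (simp add: flip_poly_def coeff_sum coeff_monom)

lemma flip_poly_0 [simp]: "flip_poly n 0 = 0"
  by (simp add: poly_eq_iff coeff_flip_poly)

lemma flip_poly_add: "flip_poly n (f + g) = flip_poly n f + flip_poly n g"
  by (simp add: poly_eq_iff coeff_flip_poly)

lemma flip_poly_smult: "flip_poly n (smult c f) = smult c (flip_poly n f)"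
  by (simp add: poly_eq_iff coeff_flip_poly)

lemma poly_eq_sum_atMost:
  fixes f :: "'a::comm_semiring_1 poly"
  assumes "degree f \<le> n" shows "poly f x = (\<Sum>i\<le>n. coeff f i * x ^ i)"
  unfolding poly_altdef
  by (rule sum.mono_neutral_left) (use assms in \<open>auto simp: coeff_eq_0\<close>)

lemma poly_flip_poly:
  fixes f :: "'a::comm_ring_1 poly"
  assumes "degree f \<le> n" "x * z = 1"
  shows "poly (flip_poly n f) x = x ^ n * poly f z"
proof -
  have "poly (flip_poly n f) x = (\<Sum>i\<le>n. coeff f (n - i) * x ^ i)"
    by (simp add: flip_poly_def poly_sum poly_monom)
  also have "\<dots> = (\<Sum>i\<le>n. coeff f i * x ^ (n - i))"
    by (rule sum.reindex_bij_witness[of _ "\<lambda>i. n - i" "\<lambda>i. n - i"]) auto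
  also have "\<dots> = (\<Sum>i\<le>n. x ^ n * (coeff f i * z ^ i))"
  proof (rule sum.cong)
    fix i assume "i \<in> {..n}"
    then have "x ^ n * z ^ i = x ^ (n - i) * (x * z) ^ i"
      unfolding power_mult_distrib mult.assoc[symmetric] power_add[symmetric] by simp
    then show "coeff f i * x ^ (n - i) = x ^ n * (coeff f i * z ^ i)"
      by (simp add: assms ac_simps)
  qed simp
  finally show ?thesis by (simp add: poly_eq_sum_atMost[OF assms(1)] sum_distrib_left)
qed

lemma flip_poly_eq_reflect_poly:
  fixes g :: "'a::comm_semiring_1 poly"
  assumes "degree g \<le> n"
  shows "flip_poly n g = monom 1 (n - degree g) * reflect_poly g"
  using assms
  by (auto simp: poly_eq_iff coeff_flip_poly coeff_monom_mult coeff_reflect_poly coeff_eq_0)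

text \<open>The order of vanishing of a binary form at a point other than \<open>0\<close> and infinity does not depend
  on the chart; \<open>c\<close> and \<open>d\<close> are the coordinates of the point in the two charts.\<close>
lemma linear_power_dvd_flip_poly:
  fixes g :: "'a::field poly"
  assumes "[:- c, 1:] ^ m dvd g" "degree g \<le> n" "c * d = 1"
  shows "[:- d, 1:] ^ m dvd flip_poly n g"
proof -
  obtain q where q: "g = [:- c, 1:] ^ m * q" using assms(1) by (rule dvdE)
  have c: "c \<noteq> 0" using assms(3) by auto
  have "reflect_poly [:- c, 1:] = smult (- c) [:- d, 1:]"
    using assms(3) c by (simp add: reflect_poly_def)
  then have "reflect_poly g = smult (- c) [:- d, 1:] ^ m * reflect_poly q"
    by (simp only: q reflect_poly_mult reflect_poly_power)
  then have "[:- d, 1:] ^ m dvd reflect_poly g"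
    by (simp only: smult_power) (rule dvd_mult2, rule dvd_smult, rule dvd_refl)
  then show ?thesis
    unfolding flip_poly_eq_reflect_poly[OF assms(2)] by (rule dvd_mult)
qed

section \<open>Points of the projective line\<close>
lemma in_some_chart: "in_chart U0 P \<or> in_chart U1 P"
  by transfer (auto simp: proportional_def)

lemma chart_coord_mult: "in_chart U0 P \<Longrightarrow> in_chart U1 P \<Longrightarrow> chart_coord U0 P * chart_coord U1 P = 1"
  by transfer auto

lemma chart_coord_U1_at_infinity: "\<not> in_chart U0 P \<Longrightarrow> chart_coord U1 P = 0"
  by transfer auto

lemma p1_eq_finite:
  "in_chart U0 P \<Longrightarrow> in_chart U0 Q \<Longrightarrow> chart_coord U0 P = chart_coord U0 Q \<Longrightarrow> P = Q"
proof (transfer, clarsimp simp: proportional_def)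
  fix p q p' q' :: 'a
  assume "p \<noteq> 0" "p' \<noteq> 0" "q / p = q' / p'" "\<forall>c. p' = c * p \<longrightarrow> c = 0 \<or> q' \<noteq> c * q"
  then show False by (auto simp: field_simps dest!: spec[of _ "p' / p"])
qed

lemma p1_eq_infinite: "\<not> in_chart U0 P \<Longrightarrow> \<not> in_chart U0 Q \<Longrightarrow> P = Q"
proof (transfer, clarsimp simp: proportional_def)
  fix q q' :: 'a
  assume "\<forall>c. c = 0 \<or> q' \<noteq> c * q" "q \<noteq> 0"
  then show "q' = 0" by (auto dest!: spec[of _ "q' / q"])
qed

section \<open>Bihomogeneous forms as polynomials of bounded bidegree\<close>
definition bihom_monomial :: "nat \<Rightarrow> nat \<Rightarrow> nat \<Rightarrow> nat \<Rightarrow> coord \<Rightarrow>\<^sub>0 nat" where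
  "bihom_monomial k a m n = Poly_Mapping.single X0 (k - m) + Poly_Mapping.single X1 m +
     Poly_Mapping.single Y0 (a - n) + Poly_Mapping.single Y1 n"

lemma lookup_bihom_monomial [simp]:
  "Poly_Mapping.lookup (bihom_monomial k a m n) X0 = k - m"
  "Poly_Mapping.lookup (bihom_monomial k a m n) X1 = m"
  "Poly_Mapping.lookup (bihom_monomial k a m n) Y0 = a - n"
  "Poly_Mapping.lookup (bihom_monomial k a m n) Y1 = n"
  by (simp_all add: bihom_monomial_def lookup_add lookup_single)

lemma bihom_monomial_unique:
  assumes "Poly_Mapping.lookup l X0 + Poly_Mapping.lookup l X1 = k"
    and "Poly_Mapping.lookup l Y0 + Poly_Mapping.lookup l Y1 = a"
  shows "l = bihom_monomial k a (Poly_Mapping.lookup l X1) (Poly_Mapping.lookup l Y1)"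
proof (rule poly_mapping_eqI)
  fix z show "Poly_Mapping.lookup l z = Poly_Mapping.lookup
      (bihom_monomial k a (Poly_Mapping.lookup l X1) (Poly_Mapping.lookup l Y1)) z"
    using assms by (cases z) auto
qed

text \<open>The exponent of \<open>X\<^sub>1\<close> (or \<open>Y\<^sub>1\<close>) in a monomial of degree \<open>d\<close> whose dehomogenization on the given
  chart has degree \<open>m\<close>.\<close>
fun chart_exponent :: "chart \<Rightarrow> nat \<Rightarrow> nat \<Rightarrow> nat" where
  "chart_exponent U0 d m = m" | "chart_exponent U1 d m = d - m"

text \<open>Dehomogenizing is injective on monomials of fixed bidegree, so every coefficient comes from
  a single monomial.\<close>
lemma coeff_dehomogenize:
  assumes F: "F \<in> forms k a"
  shows "coeff (coeff (dehomogenize (u, v) F) m) n =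
    (if m \<le> k \<and> n \<le> a
     then Poly_Mapping.lookup F (bihom_monomial k a (chart_exponent u k m) (chart_exponent v a n))
     else 0)"
proof -
  let ?b = "bihom_monomial k a (chart_exponent u k m) (chart_exponent v a n)"
  have key: "Poly_Mapping.lookup l (x_coord u) = m \<and> Poly_Mapping.lookup l (y_coord v) = n
      \<longleftrightarrow> m \<le> k \<and> n \<le> a \<and> l = ?b" if "l \<in> Poly_Mapping.keys F" for l
  proof -
    have s: "Poly_Mapping.lookup l X0 + Poly_Mapping.lookup l X1 = k"
        "Poly_Mapping.lookup l Y0 + Poly_Mapping.lookup l Y1 = a"
      using F that by (auto simp: forms_def)
    show ?thesis
    proof
      assume *: "Poly_Mapping.lookup l (x_coord u) = m \<and> Poly_Mapping.lookup l (y_coord v) = n"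
      have "Poly_Mapping.lookup l X1 = chart_exponent u k m"
          "Poly_Mapping.lookup l Y1 = chart_exponent v a n"
        using s * by (cases u; cases v; auto)+
      moreover have "m \<le> k" "n \<le> a" using s * by (cases u; cases v; auto)+
      ultimately show "m \<le> k \<and> n \<le> a \<and> l = ?b" using bihom_monomial_unique[OF s] by simp
    qed (cases u; cases v; auto)
  qed
  have "coeff (coeff (dehomogenize (u, v) F) m) n =
     (\<Sum>l\<in>Poly_Mapping.keys F. if m \<le> k \<and> n \<le> a \<and> l = ?b then Poly_Mapping.lookup F l else 0)"
    unfolding dehomogenize_def prod.case coeff_sum
    by (rule sum.cong) (use key in \<open>auto simp: coeff_monom\<close>)
  also have "\<dots> = (if m \<le> k \<and> n \<le> a then Poly_Mapping.lookup F ?b else 0)"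
    by (auto simp: in_keys_iff sum.delta)
  finally show ?thesis .
qed

lemma dehomogenize_U1_fst:
  "F \<in> forms k a \<Longrightarrow> dehomogenize (U1, v) F = flip_poly k (dehomogenize (U0, v) F)"
  by (auto simp: poly_eq_iff coeff_dehomogenize coeff_flip_poly)

lemma dehomogenize_U1_snd:
  "F \<in> forms k a \<Longrightarrow> dehomogenize (u, U1) F = map_poly (flip_poly a) (dehomogenize (u, U0) F)"
  by (auto simp: poly_eq_iff coeff_dehomogenize coeff_flip_poly coeff_map_poly)

lemma degree_dehomogenize_le: "F \<in> forms k a \<Longrightarrow> degree (dehomogenize (u, v) F) \<le> k"
  by (rule degree_le) (auto simp: poly_eq_iff coeff_dehomogenize)

lemma degree_coeff_dehomogenize_le:
  "F \<in> forms k a \<Longrightarrow> degree (coeff (dehomogenize (u, v) F) m) \<le> a"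
  by (rule degree_le) (auto simp: coeff_dehomogenize)

lemma ex_form_dehomogenize:
  fixes f :: "'k::field poly poly"
  assumes "degree f \<le> k" "\<And>m. degree (coeff f m) \<le> a"
  shows "\<exists>F \<in> forms k a. dehomogenize (U0, U0) F = f"
proof -
  define F :: "'k mform" where "F = (\<Sum>(m, n)\<in>{..k} \<times> {..a}.
     Poly_Mapping.single (bihom_monomial k a m n) (coeff (coeff f m) n))"
  have bihom_inj: "bihom_monomial k a m n = bihom_monomial k a m' n' \<longleftrightarrow> m = m' \<and> n = n'" for m n m' n'
    by (metis lookup_bihom_monomial(2,4))
  have lookup_F: "Poly_Mapping.lookup F l =
     (\<Sum>(m, n)\<in>{..k} \<times> {..a}. if bihom_monomial k a m n = l then coeff (coeff f m) n else 0)" for l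
    unfolding F_def by (simp add: lookup_sum lookup_single when_def split_def)
  have "F \<in> forms k a"
  proof -
    have "\<exists>m\<le>k. \<exists>n\<le>a. l = bihom_monomial k a m n" if "l \<in> Poly_Mapping.keys F" for l
    proof (rule ccontr)
      assume "\<not> ?thesis"
      then have "Poly_Mapping.lookup F l = 0"
        unfolding lookup_F by (intro sum.neutral) auto
      then show False using that by (simp add: in_keys_iff)
    qed
    then show ?thesis unfolding forms_def by fastforce
  qed
  moreover have "dehomogenize (U0, U0) F = f"
  proof (intro poly_eqI)
    fix m n
    have "Poly_Mapping.lookup F (bihom_monomial k a m n) = coeff (coeff f m) n"
      if "m \<le> k" "n \<le> a"
    proof -
      have "Poly_Mapping.lookup F (bihom_monomial k a m n) =
          (\<Sum>p\<in>{..k} \<times> {..a}. if p = (m, n) then coeff (coeff f m) n else 0)"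
        unfolding lookup_F by (rule sum.cong) (auto simp: bihom_inj split: if_splits)
      then show ?thesis using that by simp
    qed
    moreover have "coeff (coeff f m) n = 0" if "\<not> (m \<le> k \<and> n \<le> a)"
      using that assms(1) assms(2)[of m] by (metis coeff_0 coeff_eq_0 le_less_trans not_le)
    ultimately show "coeff (coeff (dehomogenize (U0, U0) F) m) n = coeff (coeff f m) n"
      by (auto simp: coeff_dehomogenize[OF \<open>F \<in> forms k a\<close>])
  qed
  ultimately show ?thesis by blast
qed

section \<open>Restriction to a line of type (1,0)\<close>

text \<open>The value at \<open>P\<close> of the binary form of degree \<open>k\<close> with dehomogenization \<open>f\<close>, computed in the
  representative \<open>(1, x)\<close> of a finite point \<open>P\<close> and in the representative \<open>(0, 1)\<close> of the point at
  infinity.\<close>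
definition line_value :: "nat \<Rightarrow> 'k::field p1 \<Rightarrow> 'k poly \<Rightarrow> 'k" where
  "line_value k P f = (if in_chart U0 P then poly f (chart_coord U0 P) else coeff f k)"

text \<open>The same for a form whose coefficients are polynomials in \<open>t\<close>; the result is the restriction
  to the line over \<open>P\<close>, in the coordinate \<open>t\<close> of that line.\<close>
definition line_restriction :: "nat \<Rightarrow> 'k::field p1 \<Rightarrow> 'k poly poly \<Rightarrow> 'k poly" where
  "line_restriction k P f = (if in_chart U0 P then poly f [:chart_coord U0 P:] else coeff f k)"

lemma line_restriction_add: "line_restriction k P (f + g) = line_restriction k P f + line_restriction k P g"
  by (simp add: line_restriction_def)

lemma line_restriction_scale: "line_restriction k P ([:[:c:]:] * f) = smult c (line_restriction k P f)"
  by (simp add: line_restriction_def)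

lemma line_restriction_map_smult:
  "line_restriction k P (map_poly (\<lambda>c. smult c h) f) = smult (line_value k P f) h"
proof -
  have "poly (map_poly (\<lambda>c. smult c h) f) [:x:] = smult (poly f x) h" for x
    by (induction f) (simp_all add: map_poly_pCons smult_add_left mult.commute)
  then show ?thesis by (simp add: line_restriction_def line_value_def coeff_map_poly)
qed

lemma line_restriction_map_flip_poly:
  "line_restriction k P (map_poly (flip_poly a) f) = flip_poly a (line_restriction k P f)"
proof -
  have "poly (map_poly (flip_poly a) f) [:x:] = flip_poly a (poly f [:x:])" for x :: 'a
    by (induction f) (simp_all add: map_poly_pCons flip_poly_add flip_poly_smult)
  then show ?thesis by (simp add: line_restriction_def coeff_map_poly)
qed

text \<open>Which chart containing \<open>P\<close> is used to restrict matters only up to a unit, because two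
  representatives of \<open>P\<close> differ by a scalar.\<close>
lemma poly_dehomogenize_eq_line_restriction:
  assumes F: "F \<in> forms k a" and P: "in_chart u P"
  shows "\<exists>c. c \<noteq> 0 \<and> poly (dehomogenize (u, v) F) [:chart_coord u P:] =
    smult c (line_restriction k P (dehomogenize (U0, v) F))"
proof (cases u)
  case U0
  then show ?thesis using P by (intro exI[of _ 1]) (simp add: line_restriction_def)
next
  case U1
  show ?thesis
  proof (cases "in_chart U0 P")
    case True
    then have c: "chart_coord U1 P * chart_coord U0 P = 1"
      using P U1 chart_coord_mult by (metis mult.commute)
    then have "[:chart_coord U1 P:] * [:chart_coord U0 P:] = 1" by (simp add: mult.commute)
    from poly_flip_poly[OF degree_dehomogenize_le[OF F] this] c True show ?thesis
      by (intro exI[of _ "chart_coord U1 P ^ k"])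
        (auto simp: U1 dehomogenize_U1_fst[OF F] line_restriction_def poly_const_pow)
  next
    case False
    then show ?thesis
      by (intro exI[of _ 1]) (simp add: U1 dehomogenize_U1_fst[OF F] line_restriction_def
          chart_coord_U1_at_infinity poly_0_coeff_0 coeff_flip_poly)
  qed
qed

text \<open>A nonzero polynomial over \<open>K[t]\<close> of degree at most \<open>k\<close> has at most \<open>k\<close> roots on the projective
  line: a root at infinity makes its degree smaller than \<open>k\<close> and so costs one finite root.\<close>
lemma line_restriction_separates:
  assumes "degree f \<le> k" "finite S" "card S > k" "\<And>P. P \<in> S \<Longrightarrow> line_restriction k P f = 0"
  shows "f = 0"
proof (rule ccontr)
  assume f: "f \<noteq> 0"
  define S0 where "S0 = {P \<in> S. in_chart U0 P}"
  have fin: "finite S0" using assms(2) by (simp add: S0_def)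
  have "card S0 = card ((\<lambda>P. [:chart_coord U0 P:]) ` S0)"
    by (rule card_image[symmetric]) (auto simp: inj_on_def S0_def intro: p1_eq_finite)
  also have "\<dots> \<le> card {x. poly f x = 0}"
  proof (intro card_mono poly_roots_finite[OF f], clarify)
    fix P assume "P \<in> S0"
    then show "poly f [:chart_coord U0 P:] = 0"
      using assms(4)[of P] by (simp add: S0_def line_restriction_def)
  qed
  also have "\<dots> \<le> degree f" by (rule card_poly_roots_bound[OF f])
  finally have S0: "card S0 \<le> degree f" .
  \<comment> \<open>The degree leaves room for at most \<open>k\<close> finite points, so \<open>S\<close> contains the point at infinity.\<close>
  obtain R where R: "R \<in> S" "\<not> in_chart U0 R"
  proof (cases "S = S0")
    case True
    then show ?thesis using S0 assms(1,3) by simp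
  next
    case False
    then show ?thesis using that by (auto simp: S0_def)
  qed
  then have "S \<subseteq> insert R S0" by (auto simp: S0_def intro: p1_eq_infinite)
  then have "card S \<le> Suc (card S0)"
    using fin card_mono[of "insert R S0" S] by (simp add: card_insert_if split: if_splits)
  then have "degree f = k" using S0 assms(1,3) by simp
  moreover have "coeff f k = 0" using assms(4)[OF R(1)] R(2) by (simp add: line_restriction_def)
  ultimately show False using f leading_coeff_0_iff by blast
qed

text \<open>The product of the equations of the finite points other than \<open>P\<close> is, up to a scalar, the
  polynomial that is wanted. If infinity is one of the points other than \<open>P\<close>, then the product has degree
  less than \<open>k\<close> and so vanishes there; if \<open>P\<close> itself is infinity, then it is monic of degree \<open>k\<close>, with
  value 1 at \<open>P\<close>.\<close>
lemma ex_lagrange_poly: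
  assumes S: "finite S" "card S = Suc k" and P: "P \<in> S"
  shows "\<exists>f. degree f \<le> k \<and> (\<forall>Q\<in>S. line_value k Q f = (if Q = P then 1 else 0))"
proof -
  define A where "A = {Q \<in> S - {P}. in_chart U0 Q}"
  define g where "g = (\<Prod>Q\<in>A. [:- chart_coord U0 Q, 1:])"
  have A: "finite A" "A \<subseteq> S - {P}" using S by (auto simp: A_def)
  have card: "card (S - {P}) = k" using S P by simp
  have deg: "degree g = card A" unfolding g_def by (subst degree_prod_sum_eq) auto
  have lead: "lead_coeff g = 1" unfolding g_def by (simp add: lead_coeff_prod)
  have deg_le: "degree g \<le> k" using deg card A S by (metis card_mono finite_Diff)
  have vanish: "line_value k Q g = 0" if Q: "Q \<in> S" "Q \<noteq> P" for Q
  proof (cases "in_chart U0 Q")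
    case True
    then have "Q \<in> A" using Q by (simp add: A_def)
    then show ?thesis using True A by (auto simp: line_value_def g_def poly_prod)
  next
    case False
    then have "A \<subset> S - {P}" using Q by (auto simp: A_def)
    then have "card A < k" using card S by (metis finite_Diff psubset_card_mono)
    then show ?thesis using False deg by (simp add: line_value_def coeff_eq_0)
  qed
  have nz: "line_value k P g \<noteq> 0"
  proof (cases "in_chart U0 P")
    case True
    then have "chart_coord U0 Q \<noteq> chart_coord U0 P" if "Q \<in> A" for Q
      using that p1_eq_finite by (auto simp: A_def)
    then have "\<forall>Q\<in>A. chart_coord U0 P - chart_coord U0 Q \<noteq> 0" by fastforce
    then show ?thesis using True A by (simp add: line_value_def g_def poly_prod)
  next
    case False
    then have "A = S - {P}" using p1_eq_infinite by (auto simp: A_def)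
    then show ?thesis using False lead deg card by (simp add: line_value_def)
  qed
  have "line_value k Q (smult (inverse (line_value k P g)) g) = (if Q = P then 1 else 0)"
    if "Q \<in> S" for Q
    using vanish[OF that] nz by (auto simp: line_value_def)
  then show ?thesis using deg_le by (intro exI[of _ "smult (inverse (line_value k P g)) g"]) auto
qed

section \<open>Divisors on a line\<close>
definition finite_part :: "'k::field point multiset \<Rightarrow> 'k point set" where
  "finite_part D = {p \<in> set_mset D. in_chart U0 (snd p)}"

text \<open>The equation of a divisor in the coordinate \<open>t\<close> of its line. A point at infinity contributes
  no factor; its multiplicity is the amount by which the degree falls short of that of the
  divisor.\<close>
definition divisor_poly :: "'k::field point multiset \<Rightarrow> 'k poly" where
  "divisor_poly D = (\<Prod>p\<in>finite_part D. [:- chart_coord U0 (snd p), 1:] ^ count D p)"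

lemma finite_finite_part [simp]: "finite (finite_part D)"
  by (simp add: finite_part_def)

lemma divisor_poly_nonzero [simp]: "divisor_poly D \<noteq> 0"
  by (simp add: divisor_poly_def)

lemma degree_divisor_poly: "degree (divisor_poly D) = (\<Sum>p\<in>finite_part D. count D p)"
  unfolding divisor_poly_def by (subst degree_prod_sum_eq) (auto simp: degree_linear_power)

lemma degree_divisor_poly_le: "degree (divisor_poly D) \<le> size D"
  unfolding degree_divisor_poly size_multiset_overloaded_eq
  by (rule sum_mono2) (auto simp: finite_part_def)

lemma eq_if_snd_eq_on_line:
  assumes "set_mset D \<subseteq> fst -` {P}" "p \<in># D" "q \<in># D" "snd p = snd q"
  shows "p = q"
  using assms by (metis prod_eqI subsetD vimage_singleton_eq)

lemma degree_divisor_poly_infinite: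
  assumes D: "set_mset D \<subseteq> fst -` {P}" and p: "p \<in># D" "\<not> in_chart U0 (snd p)"
  shows "degree (divisor_poly D) + count D p = size D"
proof -
  have "set_mset D = insert p (finite_part D)" "p \<notin> finite_part D"
    using p by (auto simp: finite_part_def intro: eq_if_snd_eq_on_line[OF D _ p(1)] p1_eq_infinite)
  then show ?thesis by (simp add: size_multiset_overloaded_eq degree_divisor_poly)
qed

lemma degree_divisor_poly_finite:
  assumes "\<And>p. p \<in># D \<Longrightarrow> in_chart U0 (snd p)"
  shows "degree (divisor_poly D) = size D"
proof -
  have "finite_part D = set_mset D" using assms by (auto simp: finite_part_def)
  then show ?thesis by (simp add: size_multiset_overloaded_eq degree_divisor_poly)
qed

text \<open>Comparing orders of vanishing replaces the coprimality of the factors: the product over the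
  other points does not vanish at \<open>c x\<close>, so its cofactor in \<open>g\<close> has the same order there as \<open>g\<close>.\<close>
lemma prod_linear_powers_dvd:
  fixes g :: "'a::field poly"
  assumes "finite A" "inj_on c A" "\<And>x. x \<in> A \<Longrightarrow> [:- c x, 1:] ^ m x dvd g"
  shows "(\<Prod>x\<in>A. [:- c x, 1:] ^ m x) dvd g"
  using assms
proof (induction A rule: finite_induct)
  case (insert x A)
  let ?p = "\<Prod>x\<in>A. [:- c x, 1:] ^ m x"
  have "?p dvd g" using insert by (auto simp: inj_on_def)
  then obtain h where h: "g = ?p * h" by (rule dvdE)
  have "[:- c x, 1:] ^ m x dvd h"
  proof (cases "g = 0")
    case False
    have "poly ?p (c x) \<noteq> 0" using insert by (auto simp: poly_prod inj_on_def)
    then have "order (c x) g = order (c x) h" using False h by (simp add: order_mult order_0I)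
    then show ?thesis using insert.prems(2)[of x] False by (auto simp: order_divides)
  next
    case True
    moreover have "?p \<noteq> 0" using insert.hyps(1) by simp
    ultimately have "h = 0" using h by (metis mult_eq_0_iff)
    then show ?thesis by simp
  qed
  then show ?case using insert h by (simp add: mult.commute[of "[:- c x, 1:] ^ m x"] mult_dvd_mono)
qed simp

text \<open>The binary form of degree \<open>a\<close> with dehomogenization \<open>g\<close> lies in the ideal of \<open>D\<close>, tested in both
  charts of the line.\<close>
definition vanishes_on :: "nat \<Rightarrow> 'k::field point multiset \<Rightarrow> 'k poly \<Rightarrow> bool" where
  "vanishes_on a D g \<longleftrightarrow> (\<forall>v. \<forall>p\<in>#D. in_chart v (snd p) \<longrightarrow>
     [:- chart_coord v (snd p), 1:] ^ count D p dvd (case v of U0 \<Rightarrow> g | U1 \<Rightarrow> flip_poly a g))"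

text \<open>The finite points amount to divisibility by the equation of \<open>D\<close>. The point at infinity, with
  multiplicity \<open>m\<close>, amounts to \<open>degree g \<le> a - m\<close>, which is the bound on the cofactor because the
  equation of \<open>D\<close> has degree \<open>size D - m\<close>.\<close>
lemma vanishes_on_iff:
  assumes D: "set_mset D \<subseteq> fst -` {P}" and size: "size D \<le> a" and g: "degree g \<le> a"
  shows "vanishes_on a D g \<longleftrightarrow> divisor_poly D dvd g \<and> degree (g div divisor_poly D) \<le> a - size D"
proof
  assume van: "vanishes_on a D g"
  have "inj_on (\<lambda>p. chart_coord U0 (snd p)) (finite_part D)"
  proof (rule inj_onI)
    fix p q assume "p \<in> finite_part D" "q \<in> finite_part D"
      and "chart_coord U0 (snd p) = chart_coord U0 (snd q)"
    then have "p \<in># D" "q \<in># D" "snd p = snd q"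
      by (simp_all add: finite_part_def p1_eq_finite)
    then show "p = q" by (rule eq_if_snd_eq_on_line[OF D])
  qed
  moreover have "[:- chart_coord U0 (snd p), 1:] ^ count D p dvd g" if "p \<in> finite_part D" for p
    using van[unfolded vanishes_on_def, THEN spec[of _ U0]] that by (auto simp: finite_part_def)
  ultimately have dvd: "divisor_poly D dvd g"
    unfolding divisor_poly_def by (intro prod_linear_powers_dvd) simp_all
  then obtain h where h: "g = divisor_poly D * h" by (rule dvdE)
  have "degree h \<le> a - size D"
  proof (cases "h = 0")
    case False
    then have deg: "degree g = degree (divisor_poly D) + degree h" by (simp add: h degree_mult_eq)
    show ?thesis
    proof (cases "\<forall>p\<in>#D. in_chart U0 (snd p)")
      case True
      then show ?thesis using deg g degree_divisor_poly_finite[of D] by auto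
    next
      case False
      then obtain p where p: "p \<in># D" "\<not> in_chart U0 (snd p)" by blast
      then have "[:- chart_coord U1 (snd p), 1:] ^ count D p dvd flip_poly a g"
        using van[unfolded vanishes_on_def, THEN spec[of _ U1]] in_some_chart by auto
      then have "monom 1 (count D p) dvd flip_poly a g"
        using p by (simp add: chart_coord_U1_at_infinity monom_altdef)
      then have flip0: "coeff (flip_poly a g) i = 0" if "i < count D p" for i
        using that by (simp add: monom_1_dvd_iff')
      \<comment> \<open>The lowest coefficients of the flipped polynomial are the top coefficients of \<open>g\<close>.\<close>
      have "degree g \<le> a - count D p"
      proof (rule degree_le, intro allI impI)
        fix i assume i: "a - count D p < i"
        show "coeff g i = 0"
        proof (cases "i \<le> a")
          case True
          then show ?thesis using flip0[of "a - i"] i by (simp add: coeff_flip_poly)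
        next
          case False
          then show ?thesis using g by (simp add: coeff_eq_0)
        qed
      qed
      then show ?thesis using deg degree_divisor_poly_infinite[OF D p] size by simp
    qed
  qed simp
  then show "divisor_poly D dvd g \<and> degree (g div divisor_poly D) \<le> a - size D"
    using dvd h by simp
next
  assume *: "divisor_poly D dvd g \<and> degree (g div divisor_poly D) \<le> a - size D"
  then obtain h where h: "g = divisor_poly D * h" by (auto elim: dvdE)
  have deg_h: "degree h \<le> a - size D" using * h by simp
  have fin: "[:- chart_coord U0 (snd p), 1:] ^ count D p dvd g" if "p \<in># D" "in_chart U0 (snd p)" for p
  proof -
    have "[:- chart_coord U0 (snd p), 1:] ^ count D p dvd divisor_poly D"
      unfolding divisor_poly_def by (rule dvd_prodI) (use that in \<open>auto simp: finite_part_def\<close>)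
    then show ?thesis unfolding h by (rule dvd_mult2)
  qed
  have "[:- chart_coord U1 (snd p), 1:] ^ count D p dvd flip_poly a g"
    if p: "p \<in># D" "in_chart U1 (snd p)" for p
  proof (cases "in_chart U0 (snd p)")
    case True
    then show ?thesis
      using linear_power_dvd_flip_poly[OF fin[OF p(1) True] g] chart_coord_mult p(2) by blast
  next
    case False
    have "degree g \<le> degree (divisor_poly D) + degree h" unfolding h by (rule degree_mult_le)
    then have "degree g + count D p \<le> a"
      using deg_h degree_divisor_poly_infinite[OF D p(1) False] size by simp
    then have "monom 1 (count D p) dvd flip_poly a g"
      by (auto simp: monom_1_dvd_iff' coeff_flip_poly coeff_eq_0)
    then show ?thesis using False by (simp add: chart_coord_U1_at_infinity monom_altdef)
  qed
  then show "vanishes_on a D g" using fin unfolding vanishes_on_def by (auto split: chart.splits)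
qed

lemma degree_line_restriction_dehomogenize_le:
  assumes F: "F \<in> forms k a"
  shows "degree (line_restriction k P (dehomogenize (U0, v) F)) \<le> a"
proof -
  have "degree (poly f [:x:]) \<le> a" if "\<And>m. degree (coeff f m) \<le> a" for f and x :: 'a
    unfolding poly_altdef
    by (intro degree_sum_le) (auto simp: poly_const_pow intro: order_trans[OF degree_mult_le] that)
  then show ?thesis
    by (simp add: line_restriction_def degree_coeff_dehomogenize_le[OF F])
qed

section \<open>Sections through divisors on distinct lines\<close>

text \<open>The containment of \<open>D\<close> on the four charts of \<open>M\<close> becomes a condition on a single polynomial in
  \<open>t\<close>: restrictions computed on different charts of the first factor agree up to a scalar, and
  those on different charts of the second factor are exchanged by \<open>flip_poly\<close>.\<close>
lemma dehomogenize_in_line_divisor_scheme_iff: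
  assumes F: "F \<in> forms k a" and D: "set_mset D \<subseteq> fst -` {P}"
  shows "(\<forall>u. dehomogenize u F \<in> line_divisor_scheme D u) \<longleftrightarrow>
    vanishes_on a D (line_restriction k P (dehomogenize (U0, U0) F))"
proof -
  define g where "g v = line_restriction k P (dehomogenize (U0, v) F)" for v
  have "g U1 = flip_poly a (g U0)"
    by (simp add: g_def dehomogenize_U1_snd[OF F] line_restriction_map_flip_poly)
  then have g: "g v = (case v of U0 \<Rightarrow> g U0 | U1 \<Rightarrow> flip_poly a (g U0))" for v
    by (cases v) simp_all
  have dvd: "d dvd poly (dehomogenize (u, v) F) [:chart_coord u P:] \<longleftrightarrow> d dvd g v"
    if "in_chart u P" for u v d
    using poly_dehomogenize_eq_line_restriction[OF F that, of v] dvd_smult_iff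
    unfolding g_def by metis
  have fst: "fst p = P" if "p \<in># D" for p using D that by auto
  have "(\<forall>u. dehomogenize u F \<in> line_divisor_scheme D u) \<longleftrightarrow>
    (\<forall>u v. \<forall>p\<in>#D. in_chart u P \<and> in_chart v (snd p) \<longrightarrow>
      [:- chart_coord v (snd p), 1:] ^ count D p dvd g v)"
    by (auto simp: line_divisor_scheme_def fst dvd)
  also have "\<dots> \<longleftrightarrow> vanishes_on a D (g U0)"
    unfolding vanishes_on_def g[symmetric] using in_some_chart[of P] by blast
  finally show ?thesis by (simp add: g_def)
qed

text \<open>The restrictions to the lines identify the space of sections with the direct sum of the spaces
  of cofactors of the equations of the \<open>D i\<close>; the basis vectors and functionals below express this
  isomorphism in coordinates.\<close>
lemma dim_section_space_lines:
  fixes P :: "'i \<Rightarrow> 'k::field p1"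
  assumes I: "finite I" "card I = Suc k" and inj: "inj_on P I"
    and D: "\<And>i. i \<in> I \<Longrightarrow> set_mset (D i) \<subseteq> fst -` {P i}"
    and size: "\<And>i. i \<in> I \<Longrightarrow> size (D i) \<le> a"
  shows "form.dim (section_space k a (linear_system_minus k a
      (scheme_union I (\<lambda>i. line_divisor_scheme (D i))))) = (\<Sum>i\<in>I. Suc (a - size (D i)))"
proof -
  let ?V = "section_space k a (linear_system_minus k a
      (scheme_union I (\<lambda>i. line_divisor_scheme (D i))))"
  define r where "r i F = line_restriction k (P i) (dehomogenize (U0, U0) F)" for i F
  define J where "J = (SIGMA i:I. {..a - size (D i)})"
  define \<phi> where "\<phi> = (\<lambda>(i, j) F. coeff (r i F div divisor_poly (D i)) j)"
  have ideal: "poly_ideal (scheme_union I (\<lambda>i. line_divisor_scheme (D i)) u)" for u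
    by (intro poly_ideal_scheme_union poly_ideal_line_divisor_scheme)
  have V_iff: "F \<in> ?V \<longleftrightarrow> F \<in> forms k a \<and> (\<forall>i\<in>I. divisor_poly (D i) dvd r i F \<and>
      degree (r i F div divisor_poly (D i)) \<le> a - size (D i))" for F
  proof -
    have "F \<in> ?V \<longleftrightarrow> F \<in> forms k a \<and>
        (\<forall>i\<in>I. \<forall>u. dehomogenize u F \<in> line_divisor_scheme (D i) u)"
      unfolding section_space_linear_system_minus[OF ideal] by (auto simp: scheme_union_def)
    also have "\<dots> \<longleftrightarrow> F \<in> forms k a \<and> (\<forall>i\<in>I. vanishes_on a (D i) (r i F))"
      using dehomogenize_in_line_divisor_scheme_iff[OF _ D] unfolding r_def by blast
    also have "\<dots> \<longleftrightarrow> F \<in> forms k a \<and> (\<forall>i\<in>I. divisor_poly (D i) dvd r i F \<and>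
      degree (r i F div divisor_poly (D i)) \<le> a - size (D i))"
      using vanishes_on_iff[OF D size degree_line_restriction_dehomogenize_le]
      unfolding r_def by blast
    finally show ?thesis .
  qed
  have lagrange: "\<exists>f. degree f \<le> k \<and> (\<forall>Q\<in>P ` I. line_value k Q f = (if Q = P i then 1 else 0))" if "i \<in> I" for i
    using that I inj by (intro ex_lagrange_poly) (auto simp: card_image)
  have "\<exists>l. \<forall>i\<in>I. degree (l i) \<le> k \<and>
      (\<forall>Q\<in>P ` I. line_value k Q (l i) = (if Q = P i then 1 else 0))"
    by (rule bchoice, rule ballI, rule lagrange)
  then obtain l where l: "\<And>i. i \<in> I \<Longrightarrow> degree (l i) \<le> k"
      "\<And>i j. i \<in> I \<Longrightarrow> j \<in> I \<Longrightarrow> line_value k (P j) (l i) = (if P j = P i then 1 else 0)"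
    by blast
  have lift: "\<exists>F\<in>forms k a. dehomogenize (U0, U0) F =
      map_poly (\<lambda>c. smult c (divisor_poly (D i) * monom 1 j)) (l i)" if "(i, j) \<in> J" for i j
  proof (rule ex_form_dehomogenize)
    have i: "i \<in> I" "j \<le> a - size (D i)" using that by (auto simp: J_def)
    show "degree (map_poly (\<lambda>c. smult c (divisor_poly (D i) * monom 1 j)) (l i)) \<le> k"
      by (rule degree_le) (use l(1)[OF i(1)] in \<open>auto simp: coeff_map_poly coeff_eq_0\<close>)
    have "degree (divisor_poly (D i) * monom 1 j) \<le> size (D i) + j"
      by (rule order_trans[OF degree_mult_le]) (simp add: degree_divisor_poly_le degree_monom_eq)
    then have "degree (smult c (divisor_poly (D i) * monom 1 j)) \<le> a" for c
      using i size[OF i(1)] by (intro order_trans[OF degree_smult_le]) simp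
    then show "degree (coeff (map_poly (\<lambda>c. smult c (divisor_poly (D i) * monom 1 j)) (l i)) m) \<le> a" for m
      by (simp add: coeff_map_poly)
  qed
  have "\<exists>e. \<forall>p\<in>J. e p \<in> forms k a \<and> dehomogenize (U0, U0) (e p) =
      map_poly (\<lambda>c. smult c (divisor_poly (D (fst p)) * monom 1 (snd p))) (l (fst p))"
  proof (rule bchoice, rule ballI)
    fix p assume "p \<in> J"
    then show "\<exists>F. F \<in> forms k a \<and> dehomogenize (U0, U0) F =
        map_poly (\<lambda>c. smult c (divisor_poly (D (fst p)) * monom 1 (snd p))) (l (fst p))"
      using lift[of "fst p" "snd p"] by auto
  qed
  then obtain e where e: "\<And>p. p \<in> J \<Longrightarrow> e p \<in> forms k a"
      "\<And>i j. (i, j) \<in> J \<Longrightarrow> dehomogenize (U0, U0) (e (i, j)) =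
        map_poly (\<lambda>c. smult c (divisor_poly (D i) * monom 1 j)) (l i)"
    by fastforce
  have r_e: "r i' (e (i, j)) = (if i = i' then divisor_poly (D i) * monom 1 j else 0)"
    if "(i, j) \<in> J" "i' \<in> I" for i i' j
    using that by (simp add: r_def e(2) line_restriction_map_smult l(2) J_def inj_on_eq_iff[OF inj])
  have "form.dim ?V = card J"
  proof (rule form.dim_eq_card_dual_family[where e = e and \<phi> = \<phi>])
    show "form.subspace ?V" by (rule subspace_section_space[OF ideal])
    show "finite J" using I by (simp add: J_def)
    show "e p \<in> ?V" if "p \<in> J" for p
    proof -
      obtain i j where p: "p = (i, j)" by (cases p)
      show ?thesis unfolding V_iff using that e(1)[OF that]
        by (auto simp: p r_e J_def degree_monom_eq)
    qed
    show "\<phi> p (F + G) = \<phi> p F + \<phi> p G" for p F G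
      by (cases p) (simp add: \<phi>_def r_def dehomogenize_add line_restriction_add poly_div_add_left)
    show "\<phi> p (form_scale c F) = c * \<phi> p F" for p c F
      by (cases p) (simp add: \<phi>_def r_def dehomogenize_scale line_restriction_scale div_smult_left
          del: mult_pCons_left)
    show "\<phi> p (e q) = (if p = q then 1 else 0)" if "p \<in> J" "q \<in> J" for p q
    proof -
      obtain i j i' j' where p: "p = (i, j)" and q: "q = (i', j')" by (cases p, cases q)
      show ?thesis using that r_e[of i' j' i] by (auto simp: p q \<phi>_def J_def)
    qed
    show "F = 0" if "F \<in> ?V" and zero: "\<And>p. p \<in> J \<Longrightarrow> \<phi> p F = 0" for F
    proof -
      have F: "F \<in> forms k a" using that(1) V_iff by blast
      have "r i F = 0" if i: "i \<in> I" for i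
      proof -
        have dvd: "divisor_poly (D i) dvd r i F"
          and deg: "degree (r i F div divisor_poly (D i)) \<le> a - size (D i)"
          using \<open>F \<in> ?V\<close> i by (auto simp: V_iff)
        have "coeff (r i F div divisor_poly (D i)) j = 0" for j
        proof (cases "j \<le> a - size (D i)")
          case True
          then show ?thesis using zero[of "(i, j)"] i by (simp add: J_def \<phi>_def)
        next
          case False
          then show ?thesis using deg by (simp add: coeff_eq_0)
        qed
        then have "r i F div divisor_poly (D i) = 0" by (simp add: poly_eq_iff)
        then show ?thesis using dvd by (metis dvd_div_eq_0_iff)
      qed
      then have "dehomogenize (U0, U0) F = 0"
        using I inj by (intro line_restriction_separates[OF degree_dehomogenize_le[OF F], of "P ` I"])
          (auto simp: r_def card_image)
      then show "F = 0" using dehomogenize_eq_0[OF F] by blast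
    qed
  qed
  also have "card J = (\<Sum>i\<in>I. Suc (a - size (D i)))" using I by (simp add: J_def)
  finally show ?thesis .
qed

theorem lemma3:
  fixes a k :: nat
    and L :: "nat \<Rightarrow> 'k::alg_closed_field point set"
    and D :: "nat \<Rightarrow> 'k point multiset"
    and y :: "nat \<Rightarrow> nat"
  assumes "\<forall>i\<in>{1..k+1}. L i \<in> lines_1_0"
    and "inj_on L {1..k+1}"
    and "\<forall>i\<in>{1..k+1}. effective_divisor_on (L i) (D i) \<and> size (D i) = y i"
    and "y 1 \<le> a"
    and "\<forall>i\<in>{1..k}. y (i + 1) \<le> y i"
  shows "linear_system_dim k a
      (linear_system_minus k a (scheme_union {1..k+1} (\<lambda>i. line_divisor_scheme (D i)))) =
    int k * int a + int k + int a - (\<Sum>i=1..k+1. int (y i))"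
proof -
  have "\<exists>P. \<forall>i\<in>{1..k+1}. L i = fst -` {P i}"
    using assms(1) unfolding lines_1_0_def by (intro bchoice) auto
  then obtain P where P: "\<And>i. i \<in> {1..k+1} \<Longrightarrow> L i = fst -` {P i}" by blast
  have inj: "inj_on P {1..k+1}"
    by (rule inj_onI) (metis P assms(2) inj_onD)
  have y: "y i \<le> a" if "1 \<le> i" "i \<le> k + 1" for i
    using that
  proof (induction i rule: nat_induct_at_least)
    case (Suc i)
    then show ?case using assms(5)[rule_format, of i] by simp
  qed (rule assms(4))
  have "form.dim (section_space k a (linear_system_minus k a
      (scheme_union {1..k+1} (\<lambda>i. line_divisor_scheme (D i))))) =
      (\<Sum>i=1..k+1. Suc (a - size (D i)))"
  proof (rule dim_section_space_lines[OF _ _ inj])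
    show "set_mset (D i) \<subseteq> fst -` {P i}" "size (D i) \<le> a" if "i \<in> {1..k+1}" for i
      using assms(3) P that y by (auto simp: effective_divisor_on_def)
  qed simp_all
  also have "int \<dots> = (\<Sum>i=1..k+1. int a + 1 - int (y i))"
    unfolding of_nat_sum by (rule sum.cong) (use assms(3) y in \<open>auto simp: of_nat_diff\<close>)
  also have "\<dots> = (int k + 1) * (int a + 1) - (\<Sum>i=1..k+1. int (y i))"
    by (simp add: sum_subtractf)
  finally show ?thesis by (simp add: linear_system_dim_def algebra_simps)
qed

end
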